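(* Suppose $f$ is differentiable and there exist constants $L>0$ and $\gamma>1$ such that for all $x,s,s_-\in\mathrm{dom}(f)$ and $\theta\in[0,1]$ $$D_f((1-\theta)x + \theta s,(1-\theta)x + \theta s_{-}) \le L \theta^{\gamma} D_h(s,s_{-}),$$ and suppose that, for some $r>1$, the fast Bregman proximal gradient algorithm described in the context chooses at every iteration $k=0,1,\dots$ a stepsize $t_k$ that is $r$-large (as defined in the context) for the condition $$t_k\mathcal{D}(x_k,y_k,s_{k},\theta_k)/\theta_k \le D_h(s_{k},s_{k-1}).$$ Then the sequence $x_k$, $k=1,2,\dots$, satisfies $$f(x_k) +\Psi(x_k) - (f(x) + \Psi(x)) \le \frac{ \gamma^\gamma r^\gamma L\,D_h(x, x_0)}{(k+\gamma-1)^\gamma}$$ for all $x\in E$.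
   Context: Setting. $E$ is a real vector space with continuous dual $E^*$ and pairing $\langle\cdot,\cdot\rangle$; $f,\Psi:E\to\mathbb{R}\cup\{\infty\}$ are closed convex with $\mathrm{dom}(\Psi)\subseteq\mathrm{dom}(\partial f)$; $h:E\to\mathbb{R}\cup\{\infty\}$ is a convex differentiable reference function with $\mathrm{dom}(\Psi)\subseteq\overline{\mathrm{dom}(h)}$. $D_h(s,z)=h(s)-h(z)-\langle\nabla h(z),s-z\rangle$ (equal to $+\infty$ if $s\notin\mathrm{dom}(h)$) and $D_f(y,x)=f(y)-f(x)-\langle\nabla f(x),y-x\rangle$. Admissibility. $t>0$ is admissible for $(s_-,g)$ if $\min_s\{t(\langle g,s\rangle+\Psi(s))+D_h(s,s_-)\}$ has a solution $\bar s$ satisfying $t(g+g^\Psi)+\nabla h(\bar s)-\nabla h(s_-)=0$ for some $g^\Psi\in\partial\Psi(\bar s)$. Standing assumptions. (a) $f+\Psi$ is bounded below. (b) If $t>0$ and $(s_-,g)$ are such that $s\mapsto t(\langle g,s\rangle+\Psi(s))+D_h(s,s_-)$ is bounded below, then $t$ is admissible for $(s_-,g)$. (c) There is an oracle that, given $(t,s_-,g)$, either determines that $t$ is not admissible for $(s_-,g)$ or returns an optimal solution $\bar s$ of $\min_s\{t(\langle g,s\rangle+\Psi(s))+D_h(s,s_-)\}$ satisfying $t(g+g^\Psi)+\nabla h(\bar s)-\nabla h(s_-)=0$ for some $g^\Psi\in\partial\Psi(\bar s)$. Algorithm. Input $x_0:=s_{-1}\in\mathrm{dom}(\partial f)\cap\mathrm{dom}(h)$.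 For $k=0,1,\dots$: pick $t_k>0$ and set $\theta_k=t_k/\sum_{i=0}^kt_i$ (so $\theta_0=1$), $y_k=(1-\theta_k)x_k+\theta_ks_{k-1}$, where $t_k$ is admissible for $(s_{k-1},\nabla f(y_k))$; let $s_k\in\mathrm{argmin}_s\{t_k(\langle\nabla f(y_k),s\rangle+\Psi(s))+D_h(s,s_{k-1})\}$ (the solution returned by the oracle); let $x_{k+1}=(1-\theta_k)x_k+\theta_ks_k$. The function $\mathcal{D}$ (with the convention $0\cdot\infty=0$). $$\mathcal{D}(x,y,s,\theta)=(f+\Psi)(x+\theta(s-x))-(1-\theta)(f+\Psi)(x)-\theta(f+\Psi)(s)+\theta D_f(s,y).$$ $r$-large. At iteration $k$, for $t>0$ let $\theta(t)=t/(t+\sum_{i=0}^{k-1}t_i)$ and $y(t)=(1-\theta(t))x_k+\theta(t)s_{k-1}$; if $t$ is admissible for $(s_{k-1},\nabla f(y(t)))$ let $s(t)$ be the solution returned by the oracle, and call $t$ acceptable if moreover $t\,\mathcal{D}(x_k,y(t),s(t),\theta(t))/\theta(t)\le D_h(s(t),s_{k-1})$. The stepsize $t_k$ is $r$-large if it is acceptable and within a factor $r$ of the largest acceptable one, i.e. $t_k\ge t/r$ for every acceptable $t$. *)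

theory Defs
  imports "HOL-Analysis.Analysis"
begin

text \<open>Real topological vector spaces, not necessarily normed, Hausdorff or locally convex.\<close>

class real_topological_vector = real_vector + topological_ab_group_add +
  assumes tendsto_scaleR_Pair:
    "LIM p (nhds c \<times>\<^sub>F nhds v). fst p *\<^sub>R snd p :> nhds (c *\<^sub>R v)"

instance real_normed_vector \<subseteq> real_topological_vector
proof
  fix c :: real and v :: 'a
  have "((\<lambda>p. fst p *\<^sub>R snd p) \<longlongrightarrow> c *\<^sub>R v) (nhds (c, v))"
    using tendsto_scaleR[OF tendsto_fst[OF filterlim_ident] tendsto_snd[OF filterlim_ident], of "(c, v)"]
    by simp
  then show "LIM p (nhds c \<times>\<^sub>F nhds v). fst p *\<^sub>R snd p :> nhds (c *\<^sub>R v)"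
    by (simp add: nhds_prod)
qed

text \<open>The continuous dual; the pairing of \<open>u\<close> with \<open>v\<close> is the application \<open>u v\<close>.\<close>

definition continuous_dual :: "('a::real_topological_vector \<Rightarrow> real) set" where
  "continuous_dual = {u. linear u \<and> continuous_on UNIV u}"

text \<open>Functions with values in \<open>\<real> \<union> {\<infinity>}\<close> are \<open>ereal\<close>-valued functions that
  never take the value \<open>-\<infinity>\<close>.\<close>

definition effective_domain :: "('a \<Rightarrow> ereal) \<Rightarrow> 'a set" where
  "effective_domain f = {x. f x < \<infinity>}"

definition epigraph :: "('a \<Rightarrow> ereal) \<Rightarrow> ('a \<times> real) set" where
  "epigraph f = {(x, a). f x \<le> ereal a}"

definition convex_function :: "('a::real_vector \<Rightarrow> ereal) \<Rightarrow> bool" where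
  "convex_function f \<longleftrightarrow> (\<forall>x. f x \<noteq> -\<infinity>) \<and> convex (epigraph f)"

definition closed_convex_function :: "('a::real_topological_vector \<Rightarrow> ereal) \<Rightarrow> bool" where
  "closed_convex_function f \<longleftrightarrow> convex_function f \<and> closed (epigraph f)"

definition bounded_below :: "('a \<Rightarrow> ereal) \<Rightarrow> bool" where
  "bounded_below f \<longleftrightarrow> (\<exists>c::real. \<forall>x. ereal c \<le> f x)"

definition subdifferential ::
    "('a::real_topological_vector \<Rightarrow> ereal) \<Rightarrow> 'a \<Rightarrow> ('a \<Rightarrow> real) set" where
  "subdifferential f x =
    {u \<in> continuous_dual. x \<in> effective_domain f \<and> (\<forall>y. f x + ereal (u (y - x)) \<le> f y)}"

text \<open>Gateaux differentiability with gradient in the continuous dual. It requires finiteness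
  of the function on a two-sided segment around \<open>z\<close> in every direction; on a normed space it is
  implied by Frechet differentiability, with the same gradient.\<close>

definition has_gradient ::
    "('a::real_topological_vector \<Rightarrow> ereal) \<Rightarrow> 'a \<Rightarrow> ('a \<Rightarrow> real) \<Rightarrow> bool" where
  "has_gradient f z u \<longleftrightarrow> u \<in> continuous_dual \<and> \<bar>f z\<bar> \<noteq> \<infinity> \<and>
    (\<forall>d. ((\<lambda>\<tau>. (f (z + \<tau> *\<^sub>R d) - f z) / ereal \<tau>) \<longlongrightarrow> ereal (u d)) (at 0))"

definition gradient :: "('a::real_topological_vector \<Rightarrow> ereal) \<Rightarrow> 'a \<Rightarrow> 'a \<Rightarrow> real" where
  "gradient f z = (THE u. has_gradient f z u)"

definition differentiable_function :: "('a::real_topological_vector \<Rightarrow> ereal) \<Rightarrow> bool" where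
  "differentiable_function f \<longleftrightarrow> (\<forall>z \<in> effective_domain f. \<exists>u. has_gradient f z u)"

text \<open>For \<open>z \<in> effective_domain h\<close> and \<open>s \<notin> effective_domain h\<close> the formula yields \<open>\<infinity>\<close>. The formula makes no sense
  for \<open>z \<notin> effective_domain h\<close>, where the value is \<open>\<infinity>\<close> by convention.\<close>

definition bregman :: "('a::real_topological_vector \<Rightarrow> ereal) \<Rightarrow> 'a \<Rightarrow> 'a \<Rightarrow> ereal" where
  "bregman h s z =
    (if z \<in> effective_domain h then h s - h z - ereal (gradient h z (s - z)) else \<infinity>)"

definition prox_objective ::
    "('a::real_topological_vector \<Rightarrow> ereal) \<Rightarrow> ('a \<Rightarrow> ereal) \<Rightarrow> real \<Rightarrow> 'a \<Rightarrow> ('a \<Rightarrow> real) \<Rightarrow> 'a \<Rightarrow> ereal"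
  where
  "prox_objective \<Psi> h t z g s = ereal t * (ereal (g s) + \<Psi> s) + bregman h s z"

text \<open>The conditions \<open>z \<in> effective_domain h\<close> and \<open>s \<in> effective_domain h\<close> say that the two gradients of \<open>h\<close> exist.\<close>

definition prox_solution ::
    "('a::real_topological_vector \<Rightarrow> ereal) \<Rightarrow> ('a \<Rightarrow> ereal) \<Rightarrow> real \<Rightarrow> 'a \<Rightarrow> ('a \<Rightarrow> real) \<Rightarrow> 'a \<Rightarrow> bool"
  where
  "prox_solution \<Psi> h t z g s \<longleftrightarrow>
    z \<in> effective_domain h \<and> s \<in> effective_domain h \<and>
    (\<forall>s'. prox_objective \<Psi> h t z g s \<le> prox_objective \<Psi> h t z g s') \<and>
    (\<exists>g\<^sub>\<Psi> \<in> subdifferential \<Psi> s.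
       (\<lambda>v. t * (g v + g\<^sub>\<Psi> v) + gradient h s v - gradient h z v) = (\<lambda>v. 0))"

definition admissible ::
    "('a::real_topological_vector \<Rightarrow> ereal) \<Rightarrow> ('a \<Rightarrow> ereal) \<Rightarrow> real \<Rightarrow> 'a \<Rightarrow> ('a \<Rightarrow> real) \<Rightarrow> bool"
  where
  "admissible \<Psi> h t z g \<longleftrightarrow> t > 0 \<and> (\<exists>s. prox_solution \<Psi> h t z g s)"

text \<open>An oracle answers \<open>None\<close> when it determines that \<open>t\<close> is not admissible.\<close>

type_synonym 'a oracle_map = "real \<Rightarrow> 'a \<Rightarrow> ('a \<Rightarrow> real) \<Rightarrow> 'a option"

definition prox_oracle ::
    "('a::real_topological_vector \<Rightarrow> ereal) \<Rightarrow> ('a \<Rightarrow> ereal) \<Rightarrow> 'a oracle_map \<Rightarrow> bool" where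
  "prox_oracle \<Psi> h orac \<longleftrightarrow>
    (\<forall>t > 0. \<forall>z \<in> effective_domain h. \<forall>g \<in> continuous_dual.
       (case orac t z g of
          None \<Rightarrow> \<not> admissible \<Psi> h t z g
        | Some s \<Rightarrow> prox_solution \<Psi> h t z g s))"

text \<open>The convention \<open>0 \<cdot> \<infinity> = 0\<close> is that of \<open>ereal\<close>.\<close>

definition discrepancy ::
    "('a::real_topological_vector \<Rightarrow> ereal) \<Rightarrow> ('a \<Rightarrow> ereal) \<Rightarrow> 'a \<Rightarrow> 'a \<Rightarrow> 'a \<Rightarrow> real \<Rightarrow> ereal"
  where
  "discrepancy f \<Psi> x y s \<theta> =
    (f (x + \<theta> *\<^sub>R (s - x)) + \<Psi> (x + \<theta> *\<^sub>R (s - x)))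
    - ereal (1 - \<theta>) * (f x + \<Psi> x) - ereal \<theta> * (f s + \<Psi> s) + ereal \<theta> * bregman f s y"

text \<open>The sequence \<open>s\<close> is shifted by one: \<open>s k\<close> stands for \<open>s\<^sub>k\<^sub>-\<^sub>1\<close> of the informal algorithm,
  so that \<open>s 0\<close> is the input \<open>s\<^sub>-\<^sub>1\<close>.\<close>

definition fast_bregman_proximal_gradient ::
    "('a::real_topological_vector \<Rightarrow> ereal) \<Rightarrow> ('a \<Rightarrow> ereal) \<Rightarrow> ('a \<Rightarrow> ereal) \<Rightarrow> 'a oracle_map \<Rightarrow>
     (nat \<Rightarrow> real) \<Rightarrow> (nat \<Rightarrow> 'a) \<Rightarrow> (nat \<Rightarrow> 'a) \<Rightarrow> bool" where
  "fast_bregman_proximal_gradient f \<Psi> h orac t x s \<longleftrightarrow>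
    subdifferential f (x 0) \<noteq> {} \<and> x 0 \<in> effective_domain h \<and> s 0 = x 0 \<and>
    (\<forall>k. let \<theta> = t k / (\<Sum>i\<le>k. t i);
             y = (1 - \<theta>) *\<^sub>R x k + \<theta> *\<^sub>R s k
         in t k > 0 \<and>
            admissible \<Psi> h (t k) (s k) (gradient f y) \<and>
            orac (t k) (s k) (gradient f y) = Some (s (Suc k)) \<and>
            x (Suc k) = (1 - \<theta>) *\<^sub>R x k + \<theta> *\<^sub>R s (Suc k))"

text \<open>Here \<open>x\<close> and \<open>z\<close> are the current points \<open>x\<^sub>k\<close> and \<open>s\<^sub>k\<^sub>-\<^sub>1\<close>, and \<open>T\<close> is the sum of the
  previous stepsizes.\<close>

definition acceptable ::
    "('a::real_topological_vector \<Rightarrow> ereal) \<Rightarrow> ('a \<Rightarrow> ereal) \<Rightarrow> ('a \<Rightarrow> ereal) \<Rightarrow> 'a oracle_map \<Rightarrow>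
     'a \<Rightarrow> 'a \<Rightarrow> real \<Rightarrow> real \<Rightarrow> bool" where
  "acceptable f \<Psi> h orac x z T t \<longleftrightarrow>
    (let \<theta> = t / (t + T);
         y = (1 - \<theta>) *\<^sub>R x + \<theta> *\<^sub>R z
     in t > 0 \<and> admissible \<Psi> h t z (gradient f y) \<and>
        (\<exists>s. orac t z (gradient f y) = Some s \<and>
             ereal t * discrepancy f \<Psi> x y s \<theta> / ereal \<theta> \<le> bregman h s z))"

definition r_large ::
    "real \<Rightarrow> ('a::real_topological_vector \<Rightarrow> ereal) \<Rightarrow> ('a \<Rightarrow> ereal) \<Rightarrow> ('a \<Rightarrow> ereal) \<Rightarrow> 'a oracle_map \<Rightarrow>
     (nat \<Rightarrow> real) \<Rightarrow> (nat \<Rightarrow> 'a) \<Rightarrow> (nat \<Rightarrow> 'a) \<Rightarrow> nat \<Rightarrow> bool" where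
  "r_large r f \<Psi> h orac t x s k \<longleftrightarrow>
    acceptable f \<Psi> h orac (x k) (s k) (\<Sum>i<k. t i) (t k) \<and>
    (\<forall>t'. acceptable f \<Psi> h orac (x k) (s k) (\<Sum>i<k. t i) t' \<longrightarrow> t k \<ge> t' / r)"

end

theory Submission
  imports Defs
begin

text \<open>Write \<open>F = f + \<Psi>\<close> and let \<open>S\<^sub>k\<close> be the sum of the first \<open>k\<close> stepsizes. The rate comes
  from two facts.

  First, every accepted stepsize makes the potential
  \<open>S\<^sub>k (F(x\<^sub>k) - F(u)) + D\<^sub>h(u, s\<^sub>k\<^sub>-\<^sub>1)\<close> nonincreasing (\<open>accelerated_step_estimate\<close>). It starts at
  \<open>D\<^sub>h(u, x\<^sub>0)\<close> because \<open>S\<^sub>0 = 0\<close>, and \<open>D\<^sub>h \<ge> 0\<close>, so \<open>F(x\<^sub>k) - F(u) \<le> D\<^sub>h(u, x\<^sub>0) / S\<^sub>k\<close>.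

  Second, \<open>S\<^sub>k\<close> grows like \<open>k\<^sup>\<gamma>\<close>. The smoothness inequality makes every stepsize with
  \<open>L t \<theta>\<^sup>\<gamma>\<^sup>-\<^sup>1 \<le> 1\<close> acceptable (\<open>small_stepsize_acceptable\<close>). An \<open>r\<close>-large stepsize falls short
  of this threshold by at most the factor \<open>r\<close>, whence \<open>r\<^sup>\<gamma> L t\<^sub>k \<theta>\<^sub>k\<^sup>\<gamma>\<^sup>-\<^sup>1 \<ge> 1\<close>
  (\<open>large_stepsize_lower_bound\<close>). As \<open>\<theta>\<^sub>k = t\<^sub>k / S\<^sub>k\<^sub>+\<^sub>1\<close>, this is a recursion that bounds the increments
  of \<open>S\<^sub>k\<close> below by a multiple of \<open>S\<^sub>k\<^sub>+\<^sub>1\<^bsup>1-1/\<gamma>\<^esup>\<close>. It forces \<open>S\<^sub>k\<^bsup>1/\<gamma>\<^esup>\<close> to grow linearly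
  (\<open>stepsize_sum_growth\<close>).\<close>

section \<open>Calculus of extended-real convex functions\<close>

lemma effective_domain_iff_real:
  assumes "convex_function f"
  shows "v \<in> effective_domain f \<longleftrightarrow> f v = ereal (real_of_ereal (f v))"
  using assms by (cases "f v") (auto simp: convex_function_def effective_domain_def)

lemma convex_function_segment:
  assumes f: "convex_function f"
    and u: "u \<in> effective_domain f" and v: "v \<in> effective_domain f"
    and \<theta>: "0 \<le> \<theta>" "\<theta> \<le> 1"
  shows "f ((1 - \<theta>) *\<^sub>R u + \<theta> *\<^sub>R v)
    \<le> ereal ((1 - \<theta>) * real_of_ereal (f u) + \<theta> * real_of_ereal (f v))"
proof -
  have "convex (epigraph f)"
    using f by (simp add: convex_function_def)
  moreover have "(u, real_of_ereal (f u)) \<in> epigraph f" "(v, real_of_ereal (f v)) \<in> epigraph f"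
    using u v effective_domain_iff_real[OF f] by (simp_all add: epigraph_def)
  ultimately have "(1 - \<theta>) *\<^sub>R (u, real_of_ereal (f u)) + \<theta> *\<^sub>R (v, real_of_ereal (f v)) \<in> epigraph f"
    using \<theta> by (intro convexD) auto
  then show ?thesis
    by (simp add: epigraph_def)
qed

lemma effective_domain_segment:
  assumes "convex_function f" "u \<in> effective_domain f" "v \<in> effective_domain f"
    and "0 \<le> \<theta>" "\<theta> \<le> 1"
  shows "(1 - \<theta>) *\<^sub>R u + \<theta> *\<^sub>R v \<in> effective_domain f"
  using convex_function_segment[OF assms] by (auto simp: effective_domain_def)

lemma has_gradient_unique:
  assumes "has_gradient f z u" "has_gradient f z v"
  shows "u = v"
proof
  fix d
  have "ereal (u d) = ereal (v d)"
    using assms unfolding has_gradient_def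
    by (meson tendsto_unique trivial_limit_at)
  then show "u d = v d" by simp
qed

lemma has_gradient_gradient:
  assumes "differentiable_function f" "z \<in> effective_domain f"
  shows "has_gradient f z (gradient f z)"
proof -
  obtain u where u: "has_gradient f z u"
    using assms by (auto simp: differentiable_function_def)
  show ?thesis
    unfolding gradient_def using u has_gradient_unique[OF _ u] by (rule theI)
qed

lemma gradient_in_continuous_dual:
  assumes "differentiable_function f" "z \<in> effective_domain f"
  shows "gradient f z \<in> continuous_dual"
  using has_gradient_gradient[OF assms] by (simp add: has_gradient_def)

lemma linear_continuous_dual: "u \<in> continuous_dual \<Longrightarrow> linear u"
  by (simp add: continuous_dual_def)

lemma bregman_eq_real:
  assumes "convex_function f" "z \<in> effective_domain f" "v \<in> effective_domain f"
  shows "bregman f v z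
    = ereal (real_of_ereal (f v) - real_of_ereal (f z) - gradient f z (v - z))"
proof -
  have "f v = ereal (real_of_ereal (f v))" "f z = ereal (real_of_ereal (f z))"
    using assms effective_domain_iff_real by blast+
  then show ?thesis
    using assms(2) unfolding bregman_def by (metis ereal_minus(1))
qed

text \<open>Along the segment from \<open>z\<close> to \<open>v\<close>, the difference quotients of a convex function at
  \<open>z\<close> are at most the full increment; their limit is the directional derivative.\<close>

lemma bregman_nonneg:
  assumes f: "convex_function f" and diff: "differentiable_function f"
    and z: "z \<in> effective_domain f" and v: "v \<in> effective_domain f"
  shows "real_of_ereal (bregman f v z) \<ge> 0"
proof -
  let ?a = "real_of_ereal (f z)" and ?b = "real_of_ereal (f v)"
  have fz: "f z = ereal ?a"
    using z effective_domain_iff_real[OF f] by blast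
  have "((\<lambda>\<tau>. (f (z + \<tau> *\<^sub>R (v - z)) - f z) / ereal \<tau>)
      \<longlongrightarrow> ereal (gradient f z (v - z))) (at_right 0)"
    using has_gradient_gradient[OF diff z] unfolding has_gradient_def
    by (meson at_le filterlim_mono order_refl subset_UNIV)
  moreover have "\<forall>\<^sub>F \<tau> in at_right (0::real).
      (f (z + \<tau> *\<^sub>R (v - z)) - f z) / ereal \<tau> \<le> ereal (?b - ?a)"
    using eventually_at_right_real[OF zero_less_one]
  proof eventually_elim
    case (elim \<tau>)
    have eq: "z + \<tau> *\<^sub>R (v - z) = (1 - \<tau>) *\<^sub>R z + \<tau> *\<^sub>R v"
      by (simp add: algebra_simps)
    have le: "f (z + \<tau> *\<^sub>R (v - z)) \<le> ereal ((1 - \<tau>) * ?a + \<tau> * ?b)"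
      unfolding eq using elim by (intro convex_function_segment f z v) auto
    then have "z + \<tau> *\<^sub>R (v - z) \<in> effective_domain f"
      by (auto simp: effective_domain_def)
    then obtain c where c: "f (z + \<tau> *\<^sub>R (v - z)) = ereal c"
      using effective_domain_iff_real[OF f] by metis
    have "c \<le> (1 - \<tau>) * ?a + \<tau> * ?b"
      using le unfolding c ereal_less_eq .
    then have "(c - ?a) / \<tau> \<le> ?b - ?a"
      using elim by (simp add: field_simps)
    then show ?case
      using elim by (subst fz) (simp add: c)
  qed
  ultimately have "ereal (gradient f z (v - z)) \<le> ereal (?b - ?a)"
    by (intro tendsto_upperbound) auto
  then show ?thesis
    by (simp add: bregman_eq_real[OF f z v])
qed

lemma discrepancy_eq_real:
  assumes f: "convex_function f" and \<Psi>: "convex_function \<Psi>"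
    and sub: "effective_domain \<Psi> \<subseteq> effective_domain f"
    and y: "y \<in> effective_domain f" and s: "s \<in> effective_domain \<Psi>"
    and xs: "x + \<theta> *\<^sub>R (s - x) \<in> effective_domain \<Psi>"
    and x: "x \<in> effective_domain \<Psi> \<or> \<theta> = 1"
  shows "discrepancy f \<Psi> x y s \<theta> = ereal (
    real_of_ereal (f (x + \<theta> *\<^sub>R (s - x)) + \<Psi> (x + \<theta> *\<^sub>R (s - x)))
    - (1 - \<theta>) * real_of_ereal (f x + \<Psi> x) - \<theta> * real_of_ereal (f s + \<Psi> s)
    + \<theta> * real_of_ereal (bregman f s y))"
proof -
  have fin: "f v + \<Psi> v = ereal (real_of_ereal (f v + \<Psi> v))" if "v \<in> effective_domain \<Psi>" for v
  proof -
    have "f v = ereal (real_of_ereal (f v))" "\<Psi> v = ereal (real_of_ereal (\<Psi> v))"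
      using that sub effective_domain_iff_real[OF f] effective_domain_iff_real[OF \<Psi>] by blast+
    then show ?thesis
      by (metis plus_ereal.simps(1) real_of_ereal.simps(1))
  qed
  (* For \<theta> = 1 the value at x has weight 0 and may be infinite. *)
  have px: "ereal (1 - \<theta>) * (f x + \<Psi> x) = ereal ((1 - \<theta>) * real_of_ereal (f x + \<Psi> x))"
  proof (cases "\<theta> = 1")
    case False
    then show ?thesis
      using fin[of x] x by (metis times_ereal.simps(1))
  qed (simp add: zero_ereal_def[symmetric])
  have pb: "bregman f s y = ereal (real_of_ereal (bregman f s y))"
    using bregman_eq_real[OF f y] s sub by fastforce
  have "discrepancy f \<Psi> x y s \<theta> =
      ereal (real_of_ereal (f (x + \<theta> *\<^sub>R (s - x)) + \<Psi> (x + \<theta> *\<^sub>R (s - x))))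
      - ereal ((1 - \<theta>) * real_of_ereal (f x + \<Psi> x))
      - ereal \<theta> * ereal (real_of_ereal (f s + \<Psi> s))
      + ereal \<theta> * ereal (real_of_ereal (bregman f s y))"
    by (simp only: discrepancy_def px flip: fin[OF xs] fin[OF s] pb)
  then show ?thesis by simp
qed

section \<open>One iteration\<close>

text \<open>Expanding \<open>D\<^sub>f(s,y)\<close>, the part of the discrepancy that comes from \<open>f\<close> is
  \<open>D\<^sub>f(x\<^sub>+,y) - (1-\<theta>) D\<^sub>f(x,y)\<close> for \<open>x\<^sub>+ = x + \<theta>(s - x)\<close>; the part that comes from \<open>\<Psi>\<close> is
  nonpositive by convexity.\<close>

lemma discrepancy_le_bregman:
  assumes f: "convex_function f" and \<Psi>: "convex_function \<Psi>" and diff: "differentiable_function f"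
    and sub: "effective_domain \<Psi> \<subseteq> effective_domain f"
    and y: "y \<in> effective_domain f" and s: "s \<in> effective_domain \<Psi>"
    and xf: "x \<in> effective_domain f"
    and x: "x \<in> effective_domain \<Psi> \<or> \<theta> = 1"
    and \<theta>: "0 \<le> \<theta>" "\<theta> \<le> 1"
  shows "discrepancy f \<Psi> x y s \<theta> \<le> bregman f ((1 - \<theta>) *\<^sub>R x + \<theta> *\<^sub>R s) y"
proof -
  define p where "p = (1 - \<theta>) *\<^sub>R x + \<theta> *\<^sub>R s"
  have p: "x + \<theta> *\<^sub>R (s - x) = p"
    by (simp add: p_def algebra_simps)
  have p\<Psi>: "p \<in> effective_domain \<Psi>" and
    p\<Psi>_le: "real_of_ereal (\<Psi> p) \<le> (1 - \<theta>) * real_of_ereal (\<Psi> x) + \<theta> * real_of_ereal (\<Psi> s)"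
  proof -
    have "p \<in> effective_domain \<Psi> \<and> \<Psi> p \<le> ereal ((1 - \<theta>) * real_of_ereal (\<Psi> x) + \<theta> * real_of_ereal (\<Psi> s))"
    proof (cases "\<theta> = 1")
      case True
      then show ?thesis
        using s effective_domain_iff_real[OF \<Psi>] by (simp add: p_def)
    next
      case False
      then show ?thesis
        using x s \<theta> convex_function_segment[OF \<Psi>] effective_domain_segment[OF \<Psi>]
        by (auto simp: p_def)
    qed
    then show "p \<in> effective_domain \<Psi>"
      "real_of_ereal (\<Psi> p) \<le> (1 - \<theta>) * real_of_ereal (\<Psi> x) + \<theta> * real_of_ereal (\<Psi> s)"
      using effective_domain_iff_real[OF \<Psi>, of p] by (auto, metis ereal_less_eq(3))
  qed
  have lin: "linear (gradient f y)"
    using gradient_in_continuous_dual[OF diff y] by (rule linear_continuous_dual)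
  have gp: "gradient f y (p - y) = (1 - \<theta>) * gradient f y (x - y) + \<theta> * gradient f y (s - y)"
  proof -
    have "p - y = (1 - \<theta>) *\<^sub>R (x - y) + \<theta> *\<^sub>R (s - y)"
      by (simp add: p_def algebra_simps)
    then show ?thesis
      by (simp add: linear_add[OF lin] linear_scale[OF lin])
  qed
  have split: "real_of_ereal (f v + \<Psi> v) = real_of_ereal (f v) + real_of_ereal (\<Psi> v)"
    if "v \<in> effective_domain \<Psi>" for v
  proof -
    have "f v = ereal (real_of_ereal (f v))" "\<Psi> v = ereal (real_of_ereal (\<Psi> v))"
      using that sub effective_domain_iff_real[OF f] effective_domain_iff_real[OF \<Psi>] by blast+
    then show ?thesis
      by (metis plus_ereal.simps(1) real_of_ereal.simps(1))
  qed
  have splitx: "(1 - \<theta>) * real_of_ereal (f x + \<Psi> x)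
      = (1 - \<theta>) * real_of_ereal (f x) + (1 - \<theta>) * real_of_ereal (\<Psi> x)"
    using x split[of x] by (auto simp: distrib_left)
  have "0 \<le> (1 - \<theta>) * real_of_ereal (bregman f x y)"
    using bregman_nonneg[OF f diff y xf] \<theta> by simp
  then have Dx: "0 \<le> (1 - \<theta>) * (real_of_ereal (f x) - real_of_ereal (f y) - gradient f y (x - y))"
    by (simp add: bregman_eq_real[OF f y xf])
  have sf: "s \<in> effective_domain f" and pf: "p \<in> effective_domain f"
    using s p\<Psi> sub by auto
  have "discrepancy f \<Psi> x y s \<theta> \<le> bregman f p y"
    unfolding discrepancy_eq_real[OF f \<Psi> sub y s p\<Psi>[folded p] x] p
      bregman_eq_real[OF f y sf] bregman_eq_real[OF f y pf] split[OF s] split[OF p\<Psi>] splitx gp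
    using Dx p\<Psi>_le by (simp add: algebra_simps)
  then show ?thesis
    by (simp add: p_def)
qed


text \<open>A stepsize \<open>\<tau>\<close> with \<open>L \<tau> \<theta>\<^sup>\<gamma>\<^sup>-\<^sup>1 \<le> 1\<close> keeps the subproblem bounded below: then
  \<open>D\<^sub>h(s,z) \<ge> (\<tau>/\<theta>) D\<^sub>f(x\<^sub>+,y)\<close>, and the right-hand side has the linear term of the objective with
  the opposite sign. By \<open>\<theta> \<Psi>(s) \<ge> \<Psi>(x\<^sub>+) - (1-\<theta>) \<Psi>(x)\<close>, what remains is at least
  \<open>(\<tau>/\<theta>) (f(x\<^sub>+) + \<Psi>(x\<^sub>+))\<close> up to a constant.\<close>

lemma bounded_below_prox_objective:
  assumes f: "convex_function f" and \<Psi>: "convex_function \<Psi>" and h: "convex_function h"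
    and diff: "differentiable_function f"
    and sub: "effective_domain \<Psi> \<subseteq> effective_domain f"
    and bdd: "bounded_below (\<lambda>v. f v + \<Psi> v)"
    and smooth: "\<And>u v w \<theta>. u \<in> effective_domain f \<Longrightarrow> v \<in> effective_domain f \<Longrightarrow>
        w \<in> effective_domain f \<Longrightarrow> \<theta> \<in> {0..1} \<Longrightarrow>
        bregman f ((1 - \<theta>) *\<^sub>R u + \<theta> *\<^sub>R v) ((1 - \<theta>) *\<^sub>R u + \<theta> *\<^sub>R w)
          \<le> ereal (L * \<theta> powr \<gamma>) * bregman h v w"
    and L: "L > 0"
    and xf: "x \<in> effective_domain f" and x: "x \<in> effective_domain \<Psi> \<or> \<theta> = 1"
    and zf: "z \<in> effective_domain f" and zh: "z \<in> effective_domain h"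
    and \<theta>: "0 < \<theta>" "\<theta> \<le> 1" and \<tau>: "\<tau> > 0" and small: "L * \<tau> * \<theta> powr (\<gamma> - 1) \<le> 1"
    and y: "y = (1 - \<theta>) *\<^sub>R x + \<theta> *\<^sub>R z"
  shows "bounded_below (prox_objective \<Psi> h \<tau> z (gradient f y))"
proof -
  let ?r = real_of_ereal and ?g = "gradient f y"
  obtain m where m: "ereal m \<le> f v + \<Psi> v" for v
    using bdd by (auto simp: bounded_below_def)
  have yf: "y \<in> effective_domain f"
    unfolding y using xf zf \<theta> by (intro effective_domain_segment f) auto
  have lin: "linear ?g"
    using gradient_in_continuous_dual[OF diff yf] by (rule linear_continuous_dual)
  define C where "C = \<tau> / \<theta> * (m - (1 - \<theta>) * ?r (\<Psi> x) - ?r (f y) + \<theta> * ?g z)"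
  have "ereal C \<le> prox_objective \<Psi> h \<tau> z ?g v" for v
  proof (cases "v \<in> effective_domain \<Psi> \<and> v \<in> effective_domain h")
    case False
    have "\<Psi> v \<noteq> -\<infinity>" "h v \<noteq> -\<infinity>"
      using \<Psi> h by (auto simp: convex_function_def)
    moreover obtain b where "h z = ereal b"
      using zh effective_domain_iff_real[OF h] by metis
    ultimately have "prox_objective \<Psi> h \<tau> z ?g v = \<infinity>"
      using False zh \<tau> unfolding prox_objective_def bregman_def effective_domain_def
      by (cases "\<Psi> v"; cases "h v") auto
    then show ?thesis by simp
  next
    case True
    then have v\<Psi>: "v \<in> effective_domain \<Psi>" and vh: "v \<in> effective_domain h"
      and vf: "v \<in> effective_domain f"
      using sub by auto
    define p where "p = (1 - \<theta>) *\<^sub>R x + \<theta> *\<^sub>R v"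
    have p\<Psi>_le: "\<Psi> p \<le> ereal ((1 - \<theta>) * ?r (\<Psi> x) + \<theta> * ?r (\<Psi> v))"
    proof (cases "\<theta> = 1")
      case True
      then show ?thesis
        using v\<Psi> effective_domain_iff_real[OF \<Psi>, of v] by (simp add: p_def)
    next
      case False
      then show ?thesis
        using x v\<Psi> \<theta> convex_function_segment[OF \<Psi>] by (auto simp: p_def)
    qed
    then have "p \<in> effective_domain \<Psi>"
      by (auto simp: effective_domain_def)
    then obtain a b where ab: "f p = ereal a" "\<Psi> p = ereal b" and pf: "p \<in> effective_domain f"
      using sub effective_domain_iff_real[OF f] effective_domain_iff_real[OF \<Psi>]
      by (metis subsetD)
    have b: "b \<le> (1 - \<theta>) * ?r (\<Psi> x) + \<theta> * ?r (\<Psi> v)" and mab: "m \<le> a + b"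
      using p\<Psi>_le m[of p] by (simp_all add: ab)
    define D where "D = ?r (bregman h v z)"
    have D: "bregman h v z = ereal D"
      using bregman_eq_real[OF h zh vh] by (simp add: D_def)
    have "bregman f p y \<le> ereal (L * \<theta> powr \<gamma>) * bregman h v z"
      using smooth[OF xf vf zf, of \<theta>] \<theta> by (simp add: p_def y)
    then have Df: "a - ?r (f y) - ?g (p - y) \<le> L * \<theta> powr \<gamma> * D"
      by (simp add: D bregman_eq_real[OF f yf pf] ab)
    have "0 \<le> a - ?r (f y) - ?g (p - y)"
      using bregman_nonneg[OF f diff yf pf] by (simp add: bregman_eq_real[OF f yf pf] ab)
    then have D0: "0 \<le> D"
      using Df L \<theta> by (smt (verit) mult_pos_neg mult_pos_pos powr_gt_zero)
    have gp: "?g (p - y) = \<theta> * (?g v - ?g z)"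
    proof -
      have "p - y = \<theta> *\<^sub>R (v - z)"
        by (simp add: p_def y algebra_simps)
      then show ?thesis
        by (simp add: linear_scale[OF lin] linear_diff[OF lin])
    qed
    have "\<theta> powr \<gamma> = \<theta> * \<theta> powr (\<gamma> - 1)"
      using \<theta> by (simp add: powr_diff)
    then have "\<tau> / \<theta> * (L * \<theta> powr \<gamma> * D) = (L * \<tau> * \<theta> powr (\<gamma> - 1)) * D"
      using \<theta> by simp
    also have "\<dots> \<le> D"
      using small D0 by (simp add: mult_left_le_one_le L \<tau> less_imp_le)
    finally have "\<tau> / \<theta> * (a - ?r (f y) - \<theta> * (?g v - ?g z)) \<le> D"
      using Df \<theta> \<tau> unfolding gp by (smt (verit) divide_pos_pos mult_left_mono)
    moreover have "C \<le> \<tau> / \<theta> * (a - ?r (f y) + \<theta> * ?r (\<Psi> v) + \<theta> * ?g z)"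
      unfolding C_def using b mab \<theta> \<tau> by (intro mult_left_mono) auto
    moreover have "\<tau> / \<theta> * (a - ?r (f y) + \<theta> * ?r (\<Psi> v) + \<theta> * ?g z)
        = \<tau> / \<theta> * (a - ?r (f y) - \<theta> * (?g v - ?g z)) + \<tau> * (?g v + ?r (\<Psi> v))"
      using \<theta> by (simp add: field_simps)
    ultimately have "C \<le> \<tau> * (?g v + ?r (\<Psi> v)) + D"
      by linarith
    moreover have "\<Psi> v = ereal (?r (\<Psi> v))"
      using v\<Psi> effective_domain_iff_real[OF \<Psi>] by blast
    ultimately show ?thesis
      unfolding prox_objective_def D
      by (metis ereal_less_eq(3) plus_ereal.simps(1) times_ereal.simps(1))
  qed
  then show ?thesis
    by (auto simp: bounded_below_def)
qed

lemma prox_solution_domain: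
  assumes "prox_solution \<Psi> h \<tau> z g s"
  shows "s \<in> effective_domain \<Psi>" "s \<in> effective_domain h" "z \<in> effective_domain h"
  using assms by (auto simp: prox_solution_def subdifferential_def)

text \<open>The same threshold suffices for acceptability, because
  \<open>(\<tau>/\<theta>) \<D> \<le> (\<tau>/\<theta>) D\<^sub>f(x\<^sub>+,y) \<le> \<tau> L \<theta>\<^sup>\<gamma>\<^sup>-\<^sup>1 D\<^sub>h(s,z)\<close>.\<close>

lemma small_stepsize_acceptable:
  fixes f \<Psi> h :: "'a::real_topological_vector \<Rightarrow> ereal"
  assumes f: "convex_function f" and \<Psi>: "convex_function \<Psi>" and h: "convex_function h"
    and diff: "differentiable_function f" and diffh: "differentiable_function h"
    and sub: "effective_domain \<Psi> \<subseteq> effective_domain f"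
    and bdd: "bounded_below (\<lambda>v. f v + \<Psi> v)"
    and adm: "\<And>\<tau> z g. \<tau> > 0 \<Longrightarrow> z \<in> effective_domain h \<Longrightarrow> g \<in> continuous_dual \<Longrightarrow>
        bounded_below (prox_objective \<Psi> h \<tau> z g) \<Longrightarrow> admissible \<Psi> h \<tau> z g"
    and orac: "prox_oracle \<Psi> h orac"
    and smooth: "\<And>u v w \<theta>. u \<in> effective_domain f \<Longrightarrow> v \<in> effective_domain f \<Longrightarrow>
        w \<in> effective_domain f \<Longrightarrow> \<theta> \<in> {0..1} \<Longrightarrow>
        bregman f ((1 - \<theta>) *\<^sub>R u + \<theta> *\<^sub>R v) ((1 - \<theta>) *\<^sub>R u + \<theta> *\<^sub>R w)
          \<le> ereal (L * \<theta> powr \<gamma>) * bregman h v w"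
    and L: "L > 0" and T: "T \<ge> 0"
    and xf: "x \<in> effective_domain f" and x: "x \<in> effective_domain \<Psi> \<or> T = 0"
    and zf: "z \<in> effective_domain f" and zh: "z \<in> effective_domain h"
    and \<tau>: "\<tau> > 0" and small: "L * \<tau> * (\<tau> / (\<tau> + T)) powr (\<gamma> - 1) \<le> 1"
  shows "acceptable f \<Psi> h orac x z T \<tau>"
proof -
  define \<theta> where "\<theta> = \<tau> / (\<tau> + T)"
  define y where "y = (1 - \<theta>) *\<^sub>R x + \<theta> *\<^sub>R z"
  have \<theta>: "0 < \<theta>" "\<theta> \<le> 1" and x': "x \<in> effective_domain \<Psi> \<or> \<theta> = 1"
    using \<tau> T x by (auto simp: \<theta>_def)
  have yf: "y \<in> effective_domain f"
    unfolding y_def using xf zf \<theta> by (intro effective_domain_segment f) auto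
  note g = gradient_in_continuous_dual[OF diff yf]
  have admis: "admissible \<Psi> h \<tau> z (gradient f y)"
    by (intro adm \<tau> zh g
        bounded_below_prox_objective[OF f \<Psi> h diff sub bdd smooth L xf x' zf zh \<theta> \<tau> _ y_def]
        small[folded \<theta>_def])
  then obtain s where s: "orac \<tau> z (gradient f y) = Some s" "prox_solution \<Psi> h \<tau> z (gradient f y) s"
    using orac \<tau> zh g unfolding prox_oracle_def by (fastforce split: option.splits)
  note s\<Psi> = prox_solution_domain(1)[OF s(2)] and sh = prox_solution_domain(2)[OF s(2)]
  have sf: "s \<in> effective_domain f"
    using s\<Psi> sub by auto
  have p\<Psi>: "x + \<theta> *\<^sub>R (s - x) \<in> effective_domain \<Psi>"
  proof (cases "\<theta> = 1")
    case False
    have "(1 - \<theta>) *\<^sub>R x + \<theta> *\<^sub>R s \<in> effective_domain \<Psi>"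
      using False x' s\<Psi> \<theta> by (intro effective_domain_segment \<Psi>) auto
    then show ?thesis
      by (simp add: algebra_simps)
  qed (simp add: s\<Psi>)
  obtain \<Delta> where \<Delta>: "discrepancy f \<Psi> x y s \<theta> = ereal \<Delta>"
    using discrepancy_eq_real[OF f \<Psi> sub yf s\<Psi> p\<Psi> x'] by blast
  obtain D where D: "bregman h s z = ereal D"
    using bregman_eq_real[OF h zh sh] by blast
  have D0: "0 \<le> D"
    using bregman_nonneg[OF h diffh zh sh] by (simp add: D)
  have "discrepancy f \<Psi> x y s \<theta> \<le> bregman f ((1 - \<theta>) *\<^sub>R x + \<theta> *\<^sub>R s) y"
    using \<theta> by (intro discrepancy_le_bregman f \<Psi> diff sub yf s\<Psi> xf x') auto
  also have "\<dots> \<le> ereal (L * \<theta> powr \<gamma>) * bregman h s z"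
    unfolding y_def using \<theta> by (intro smooth xf sf zf) auto
  finally have "\<Delta> \<le> L * \<theta> powr \<gamma> * D"
    by (simp add: \<Delta> D)
  then have "\<tau> * \<Delta> / \<theta> \<le> \<tau> * (L * \<theta> powr \<gamma> * D) / \<theta>"
    using \<tau> \<theta> by (intro divide_right_mono mult_left_mono) auto
  also have "\<dots> = (L * \<tau> * \<theta> powr (\<gamma> - 1)) * D"
    using \<theta> by (simp add: powr_diff)
  also have "\<dots> \<le> D"
    using small D0 by (simp add: mult_left_le_one_le L \<tau> less_imp_le flip: \<theta>_def)
  finally have "ereal \<tau> * discrepancy f \<Psi> x y s \<theta> / ereal \<theta> \<le> bregman h s z"
    using \<theta> by (simp add: \<Delta> D)
  then show ?thesis
    unfolding acceptable_def Let_def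
    using \<tau> admis s(1) unfolding \<theta>_def y_def by blast
qed

text \<open>The gap at \<open>x\<^sub>+\<close>, weighted by \<open>t + T = t/\<theta>\<close>, is compared with the gap at \<open>x\<close>, weighted by
  \<open>T\<close>. The discrepancy is the error made when \<open>f + \<Psi>\<close> at \<open>x\<^sub>+\<close> is replaced by the average of
  its value at \<open>x\<close> and of the linearized value at \<open>s\<close>. The gradient \<open>g\<close>
  of \<open>f\<close> at \<open>y\<close> and a subgradient \<open>g\<^sub>\<Psi>\<close> of \<open>\<Psi>\<close> at \<open>s\<close> bound the latter by the value at \<open>u\<close> plus
  \<open>\<langle>g + g\<^sub>\<Psi>, s - u\<rangle>\<close>. By optimality of \<open>s\<close> and the three-point identity for \<open>D\<^sub>h\<close>, \<open>t\<close> times this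
  pairing equals \<open>D\<^sub>h(u,z) - D\<^sub>h(u,s) - D\<^sub>h(s,z)\<close>, whose last term pays for the discrepancy.\<close>

lemma accelerated_step_estimate:
  fixes f \<Psi> h :: "'a::real_topological_vector \<Rightarrow> ereal"
  assumes f: "convex_function f" and \<Psi>: "convex_function \<Psi>" and h: "convex_function h"
    and diff: "differentiable_function f" and diffh: "differentiable_function h"
    and sub: "effective_domain \<Psi> \<subseteq> effective_domain f"
    and t: "t > 0" and T: "T \<ge> 0" and \<theta>_eq: "\<theta> = t / (t + T)"
    and y: "y \<in> effective_domain f" and x: "x \<in> effective_domain \<Psi> \<or> T = 0"
    and sol: "prox_solution \<Psi> h t z (gradient f y) s"
    and acc: "ereal t * discrepancy f \<Psi> x y s \<theta> / ereal \<theta> \<le> bregman h s z"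
    and xp: "xp = (1 - \<theta>) *\<^sub>R x + \<theta> *\<^sub>R s"
    and u\<Psi>: "u \<in> effective_domain \<Psi>" and uh: "u \<in> effective_domain h"
  shows "(t + T) * (real_of_ereal (f xp + \<Psi> xp) - real_of_ereal (f u + \<Psi> u))
      + real_of_ereal (bregman h u s)
    \<le> T * (real_of_ereal (f x + \<Psi> x) - real_of_ereal (f u + \<Psi> u)) + real_of_ereal (bregman h u z)"
proof -
  let ?r = real_of_ereal and ?g = "gradient f y"
  have \<theta>: "0 < \<theta>" "\<theta> \<le> 1" and x': "x \<in> effective_domain \<Psi> \<or> \<theta> = 1"
    using t T x by (auto simp: \<theta>_eq)
  note s\<Psi> = prox_solution_domain(1)[OF sol] and sh = prox_solution_domain(2)[OF sol]
    and zh = prox_solution_domain(3)[OF sol]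
  have sf: "s \<in> effective_domain f" and uf: "u \<in> effective_domain f"
    using s\<Psi> u\<Psi> sub by auto
  have split: "?r (f v + \<Psi> v) = ?r (f v) + ?r (\<Psi> v)" if "v \<in> effective_domain \<Psi>" for v
    using that sub effective_domain_iff_real[OF f] effective_domain_iff_real[OF \<Psi>]
    by (metis plus_ereal.simps(1) real_of_ereal.simps(1) subsetD)
  have xp': "x + \<theta> *\<^sub>R (s - x) = xp"
    by (simp add: xp algebra_simps)
  have xp\<Psi>: "xp \<in> effective_domain \<Psi>"
    unfolding xp using x' s\<Psi> \<theta> effective_domain_segment[OF \<Psi>, of x s \<theta>]
    by (cases "\<theta> = 1") auto
  obtain g\<Psi> where g\<Psi>: "g\<Psi> \<in> subdifferential \<Psi> s"
    and opt: "t * (?g v + g\<Psi> v) + gradient h s v - gradient h z v = 0" for v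
    using sol unfolding prox_solution_def by metis
  have ling: "linear ?g" and linh: "linear (gradient h z)"
    using gradient_in_continuous_dual diff y diffh zh linear_continuous_dual by blast+
  have three: "t * (?g (u - s) + g\<Psi> (u - s))
      = ?r (bregman h u s) + ?r (bregman h s z) - ?r (bregman h u z)"
  proof -
    have "gradient h z (u - z) = gradient h z (u - s) + gradient h z (s - z)"
      by (simp add: linear_diff[OF linh])
    then show ?thesis
      using opt[of "u - s"]
      by (simp add: bregman_eq_real[OF h sh uh] bregman_eq_real[OF h zh sh] bregman_eq_real[OF h zh uh])
  qed
  have fu: "?r (f y) + ?g (u - y) \<le> ?r (f u)"
    using bregman_nonneg[OF f diff y uf] by (simp add: bregman_eq_real[OF f y uf])
  have "\<Psi> s + ereal (g\<Psi> (u - s)) \<le> \<Psi> u"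
    using g\<Psi> by (simp add: subdifferential_def)
  then have \<Psi>u: "?r (\<Psi> s) + g\<Psi> (u - s) \<le> ?r (\<Psi> u)"
    using s\<Psi> u\<Psi> effective_domain_iff_real[OF \<Psi>]
    by (metis ereal_less_eq(3) plus_ereal.simps(1))
  have gsplit: "?g (u - y) = ?g (u - s) + ?g (s - y)"
    by (simp add: linear_diff[OF ling])
  define \<Delta> where "\<Delta> = ?r (f xp + \<Psi> xp) - (1 - \<theta>) * ?r (f x + \<Psi> x) - \<theta> * ?r (f s + \<Psi> s)
    + \<theta> * ?r (bregman f s y)"
  have disc: "discrepancy f \<Psi> x y s \<theta> = ereal \<Delta>"
    using discrepancy_eq_real[OF f \<Psi> sub y s\<Psi> _ x'] xp\<Psi> by (simp add: xp' \<Delta>_def)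
  have acc': "t * \<Delta> / \<theta> \<le> ?r (bregman h s z)"
    using acc \<theta> by (simp add: disc bregman_eq_real[OF h zh sh])
  have lin_le: "?r (f s + \<Psi> s) - ?r (bregman f s y)
      \<le> ?r (f u + \<Psi> u) - (?g (u - s) + g\<Psi> (u - s))"
    using fu \<Psi>u gsplit by (simp add: split[OF s\<Psi>] split[OF u\<Psi>] bregman_eq_real[OF f y sf])
  have "(t + T) * \<theta> = t" and "(t + T) * (1 - \<theta>) = T" and "t / \<theta> = t + T"
    using t T by (auto simp: \<theta>_eq field_simps)
  moreover have "(t + T) * \<Delta> = (t + T) * ?r (f xp + \<Psi> xp) - ((t + T) * (1 - \<theta>)) * ?r (f x + \<Psi> x)
      - ((t + T) * \<theta>) * (?r (f s + \<Psi> s) - ?r (bregman f s y))"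
    by (simp add: \<Delta>_def algebra_simps)
  ultimately have "(t + T) * ?r (f xp + \<Psi> xp)
      = T * ?r (f x + \<Psi> x) + t * (?r (f s + \<Psi> s) - ?r (bregman f s y)) + t * \<Delta> / \<theta>"
    by (simp flip: times_divide_eq_left)
  also have "\<dots> \<le> T * ?r (f x + \<Psi> x) + t * (?r (f u + \<Psi> u) - (?g (u - s) + g\<Psi> (u - s)))
      + ?r (bregman h s z)"
    using mult_left_mono[OF lin_le, of t] t acc' by linarith
  finally show ?thesis
    using three by (simp add: algebra_simps)
qed

section \<open>Growth of the stepsizes\<close>

text \<open>Write \<open>\<theta>(\<tau>) = \<tau>/(\<tau> + T)\<close>. Since \<open>\<theta>(q t) \<le> q \<theta>(t)\<close> for \<open>q \<ge> 1\<close>, the multiple \<open>q t\<close> of \<open>t\<close>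
  with \<open>q\<^sup>\<gamma> L t \<theta>(t)\<^sup>\<gamma>\<^sup>-\<^sup>1 = 1\<close> still passes the test \<open>L \<tau> \<theta>(\<tau>)\<^sup>\<gamma>\<^sup>-\<^sup>1 \<le> 1\<close>, so that \<open>q \<le> r\<close>.\<close>

lemma large_stepsize_lower_bound:
  fixes t T L \<gamma> r :: real
  assumes t: "t > 0" and T: "T \<ge> 0" and L: "L > 0" and \<gamma>: "\<gamma> > 1" and r: "r > 1"
    and large: "\<And>\<tau>. \<tau> > 0 \<Longrightarrow> L * \<tau> * (\<tau> / (\<tau> + T)) powr (\<gamma> - 1) \<le> 1 \<Longrightarrow> \<tau> / r \<le> t"
  shows "1 / (r powr \<gamma> * L) \<le> t * (t / (t + T)) powr (\<gamma> - 1)"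
proof -
  define w where "w = L * t * (t / (t + T)) powr (\<gamma> - 1)"
  define q where "q = w powr (- 1 / \<gamma>)"
  have w: "w > 0"
    using t T L by (simp add: w_def)
  then have q: "q > 0"
    by (simp add: q_def)
  have qw: "q powr \<gamma> * w = 1"
  proof -
    have "q powr \<gamma> = w powr (- 1)"
      using \<gamma> by (simp add: q_def powr_powr)
    then show ?thesis
      using w by (simp add: powr_minus)
  qed
  have "q \<le> r"
  proof (cases "q \<le> 1")
    case False
    have "q * t / (q * t + T) \<le> q * (t / (t + T))"
    proof -
      have "q * t / (q * t + T) \<le> q * t / (t + T)"
        using False t T q by (intro divide_left_mono mult_pos_pos add_pos_nonneg) auto
      then show ?thesis by simp
    qed
    then have "(q * t / (q * t + T)) powr (\<gamma> - 1) \<le> (q * (t / (t + T))) powr (\<gamma> - 1)"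
      using t T q \<gamma> by (intro powr_mono2) auto
    also have "\<dots> = q powr (\<gamma> - 1) * (t / (t + T)) powr (\<gamma> - 1)"
      using t T q by (intro powr_mult)
    finally have "L * (q * t) * (q * t / (q * t + T)) powr (\<gamma> - 1)
        \<le> L * (q * t) * (q powr (\<gamma> - 1) * (t / (t + T)) powr (\<gamma> - 1))"
      using L q t by (intro mult_left_mono) auto
    also have "\<dots> = q powr \<gamma> * w"
      using q by (simp add: w_def powr_diff)
    finally have "q * t / r \<le> t"
      using q t by (intro large) (auto simp: qw)
    then show ?thesis
      using t r by (simp add: field_simps)
  qed (use r in simp)
  then have "1 \<le> r powr \<gamma> * w"
    using qw q \<gamma> w by (metis less_imp_le mult_right_mono powr_mono2 order_less_trans zero_less_one)
  then show ?thesis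
    using L r by (simp add: w_def field_simps)
qed

text \<open>The hypothesis says that \<open>S\<^sub>k = t\<^sub>0 + \<dots> + t\<^sub>k\<close> satisfies
  \<open>S\<^sub>k - S\<^sub>k\<^sub>-\<^sub>1 \<ge> (c S\<^sub>k\<^sup>\<gamma>\<^sup>-\<^sup>1)\<^bsup>1/\<gamma>\<^esup>\<close>. The Young inequality
  \<open>S\<^sub>k\<^sub>-\<^sub>1\<^bsup>1/\<gamma>\<^esup> S\<^sub>k\<^bsup>1-1/\<gamma>\<^esup> \<le> S\<^sub>k\<^sub>-\<^sub>1/\<gamma> + (1-1/\<gamma>) S\<^sub>k\<close> turns this into the statement that \<open>S\<^sub>k\<^bsup>1/\<gamma>\<^esup>\<close>
  increases by at least \<open>c\<^bsup>1/\<gamma>\<^esup>/\<gamma>\<close> in each step.\<close>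

lemma stepsize_sum_growth:
  fixes t :: "nat \<Rightarrow> real" and c \<gamma> :: real
  assumes t: "\<And>k. t k > 0" and c: "c > 0" and \<gamma>: "\<gamma> > 1"
    and large: "\<And>k. c \<le> t k * (t k / (\<Sum>i\<le>k. t i)) powr (\<gamma> - 1)"
  shows "c * ((real k + \<gamma>) / \<gamma>) powr \<gamma> \<le> (\<Sum>i\<le>k. t i)"
proof -
  define S where "S k = (\<Sum>i\<le>k. t i)" for k
  have S: "S k > 0" for k
    unfolding S_def using t by (intro sum_pos) auto
  define \<alpha> where "\<alpha> = 1 / \<gamma>"
  have \<alpha>: "0 < \<alpha>" "\<alpha> < 1" and \<alpha>\<gamma>: "\<alpha> * \<gamma> = 1"
    using \<gamma> by (auto simp: \<alpha>_def)
  have t_ge: "c powr \<alpha> * S k powr (1 - \<alpha>) \<le> t k" for k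
  proof -
    have "c * S k powr (\<gamma> - 1) \<le> t k powr \<gamma>"
      using large[of k] S[of k] t[of k]
      by (simp add: powr_divide powr_diff field_simps flip: S_def)
    then have "(c * S k powr (\<gamma> - 1)) powr \<alpha> \<le> (t k powr \<gamma>) powr \<alpha>"
      using c \<alpha> by (intro powr_mono2) auto
    moreover have "(\<gamma> - 1) * \<alpha> = 1 - \<alpha>"
      using \<alpha>\<gamma> by (simp add: algebra_simps)
    ultimately show ?thesis
      using c \<alpha>\<gamma> t[of k] by (simp add: powr_mult powr_powr mult.commute)
  qed
  have root: "c powr \<alpha> * (1 + \<alpha> * real k) \<le> S k powr \<alpha>" for k
  proof (induction k)
    case 0
    have "c powr \<alpha> * S 0 powr (1 - \<alpha>) \<le> S 0 powr \<alpha> * S 0 powr (1 - \<alpha>)"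
      using t_ge[of 0] t[of 0] by (simp add: S_def flip: powr_add)
    then show ?case
      using S[of 0] by simp
  next
    case (Suc k)
    let ?A = "S k" and ?B = "S (Suc k)"
    have B: "?B powr \<alpha> * ?B powr (1 - \<alpha>) = ?B"
      using S[of "Suc k"] by (simp flip: powr_add)
    have A: "?A = ?B - t (Suc k)"
      by (simp add: S_def)
    have "?A powr \<alpha> * ?B powr (1 - \<alpha>) \<le> \<alpha> * ?A + (1 - \<alpha>) * ?B"
      using \<alpha> S[of k] S[of "Suc k"] by (intro Youngs_inequality_0) auto
    also have "\<dots> = ?B - \<alpha> * t (Suc k)"
      unfolding A by (simp add: algebra_simps)
    also have "\<dots> \<le> ?B - \<alpha> * (c powr \<alpha> * ?B powr (1 - \<alpha>))"
      using t_ge[of "Suc k"] \<alpha> by simp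
    also have "\<dots> = (?B powr \<alpha> - \<alpha> * c powr \<alpha>) * ?B powr (1 - \<alpha>)"
      using B by (simp add: algebra_simps)
    finally have "?A powr \<alpha> \<le> ?B powr \<alpha> - \<alpha> * c powr \<alpha>"
      using S[of "Suc k"] by simp
    then show ?case
      using Suc by (simp add: algebra_simps)
  qed
  have "1 + \<alpha> * real k = (real k + \<gamma>) / \<gamma>"
    using \<gamma> by (simp add: \<alpha>_def field_simps)
  then have "(c powr \<alpha> * ((real k + \<gamma>) / \<gamma>)) powr \<gamma> \<le> (S k powr \<alpha>) powr \<gamma>"
    using root[of k] c \<gamma> by (intro powr_mono2) auto
  also have "(c powr \<alpha> * ((real k + \<gamma>) / \<gamma>)) powr \<gamma> = c * ((real k + \<gamma>) / \<gamma>) powr \<gamma>"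
    using c \<alpha>\<gamma> by (subst powr_mult) (simp add: powr_powr)
  also have "(S k powr \<alpha>) powr \<gamma> = (\<Sum>i\<le>k. t i)"
    using \<alpha>\<gamma> S[of k] by (simp add: powr_powr S_def less_imp_le)
  finally show ?thesis .
qed

section \<open>Convergence rate\<close>

theorem proposition5:
  fixes f \<Psi> h :: "'a::real_topological_vector \<Rightarrow> ereal"
    and orac :: "real \<Rightarrow> 'a \<Rightarrow> ('a \<Rightarrow> real) \<Rightarrow> 'a option"
    and x s :: "nat \<Rightarrow> 'a" and t :: "nat \<Rightarrow> real"
    and L \<gamma> r :: real
  assumes "closed_convex_function f" and "closed_convex_function \<Psi>"
    and "effective_domain \<Psi> \<subseteq> {v. subdifferential f v \<noteq> {}}"
    and "convex_function h" and "differentiable_function h"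
    and "effective_domain \<Psi> \<subseteq> closure (effective_domain h)"
    and "bounded_below (\<lambda>v. f v + \<Psi> v)"
    and "\<And>\<tau> z g. \<tau> > 0 \<Longrightarrow> z \<in> effective_domain h \<Longrightarrow> g \<in> continuous_dual \<Longrightarrow>
           bounded_below (prox_objective \<Psi> h \<tau> z g) \<Longrightarrow> admissible \<Psi> h \<tau> z g"
    and "prox_oracle \<Psi> h orac"
    and "differentiable_function f"
    and "L > 0" and "\<gamma> > 1"
    and "\<And>u v w \<theta>. u \<in> effective_domain f \<Longrightarrow> v \<in> effective_domain f \<Longrightarrow> w \<in> effective_domain f \<Longrightarrow> \<theta> \<in> {0..1} \<Longrightarrow>
           bregman f ((1 - \<theta>) *\<^sub>R u + \<theta> *\<^sub>R v) ((1 - \<theta>) *\<^sub>R u + \<theta> *\<^sub>R w)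
             \<le> ereal (L * \<theta> powr \<gamma>) * bregman h v w"
    and "r > 1"
    and "fast_bregman_proximal_gradient f \<Psi> h orac t x s"
    and "\<And>k. r_large r f \<Psi> h orac t x s k"
  shows "\<forall>k\<ge>1. \<forall>u. (f (x k) + \<Psi> (x k)) - (f u + \<Psi> u)
           \<le> ereal (\<gamma> powr \<gamma> * r powr \<gamma> * L) * bregman h u (x 0)
               / ereal ((real k + \<gamma> - 1) powr \<gamma>)"
proof (intro allI impI)
  fix k :: nat and u
  assume k: "k \<ge> 1"
  let ?r = real_of_ereal
  have f: "convex_function f" and \<Psi>: "convex_function \<Psi>" and h: "convex_function h"
    using assms(1,2,4) by (auto simp: closed_convex_function_def)
  note diff = \<open>differentiable_function f\<close> and diffh = \<open>differentiable_function h\<close>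
  note smooth = assms(13)
  have sub: "effective_domain \<Psi> \<subseteq> effective_domain f"
    using assms(3) by (auto simp: subdifferential_def)
  define S where "S k = (\<Sum>i<k. t i)" for k
  define \<theta> where "\<theta> k = t k / (t k + S k)" for k
  define y where "y k = (1 - \<theta> k) *\<^sub>R x k + \<theta> k *\<^sub>R s k" for k
  have sum_le: "(\<Sum>i\<le>k. t i) = t k + S k" for k
    by (simp add: S_def lessThan_Suc_atMost[symmetric])
  have x0: "x 0 \<in> effective_domain f" "x 0 \<in> effective_domain h" "s 0 = x 0"
    using assms(15) by (auto simp: fast_bregman_proximal_gradient_def subdifferential_def)
  have t: "t k > 0"
    and or: "orac (t k) (s k) (gradient f (y k)) = Some (s (Suc k))"
    and xSuc: "x (Suc k) = (1 - \<theta> k) *\<^sub>R x k + \<theta> k *\<^sub>R s (Suc k)" for k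
    using assms(15)
    by (auto simp: fast_bregman_proximal_gradient_def Let_def sum_le \<theta>_def y_def)
  have S0: "S k \<ge> 0" for k
    unfolding S_def using t by (intro sum_nonneg) (simp add: less_imp_le)
  have \<theta>: "0 < \<theta> k" "\<theta> k \<le> 1" for k
    using t[of k] S0[of k] by (auto simp: \<theta>_def)
  (* The starting point need not lie in the domain of \<Psi>; it enters x 1 with weight 0. *)
  have dom: "x k \<in> effective_domain f \<and> (x k \<in> effective_domain \<Psi> \<or> S k = 0)
      \<and> s k \<in> effective_domain f \<and> s k \<in> effective_domain h
      \<and> prox_solution \<Psi> h (t k) (s k) (gradient f (y k)) (s (Suc k))
      \<and> x (Suc k) \<in> effective_domain \<Psi>" for k
  proof -
    have step: "prox_solution \<Psi> h (t k) (s k) (gradient f (y k)) (s (Suc k))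
        \<and> x (Suc k) \<in> effective_domain \<Psi>"
      if xf: "x k \<in> effective_domain f" and x: "x k \<in> effective_domain \<Psi> \<or> S k = 0"
        and sf: "s k \<in> effective_domain f" and sh: "s k \<in> effective_domain h" for k
    proof
      have "y k \<in> effective_domain f"
        unfolding y_def using xf sf \<theta>[of k] by (intro effective_domain_segment f) auto
      then show sol: "prox_solution \<Psi> h (t k) (s k) (gradient f (y k)) (s (Suc k))"
        using assms(9) t[of k] sh gradient_in_continuous_dual[OF diff] or[of k]
        unfolding prox_oracle_def by (metis option.case(2))
      show "x (Suc k) \<in> effective_domain \<Psi>"
      proof (cases "S k = 0")
        case True
        then show ?thesis
          using prox_solution_domain(1)[OF sol] t[of k] by (simp add: xSuc \<theta>_def)
      next
        case False
        then show ?thesis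
          unfolding xSuc using prox_solution_domain(1)[OF sol] x \<theta>[of k]
          by (intro effective_domain_segment \<Psi>) auto
      qed
    qed
    show ?thesis
    proof (induction k)
      case 0
      then show ?case
        using step[of 0] x0 by (simp add: S_def)
    next
      case (Suc k)
      then show ?case
        using step[of "Suc k"] sub prox_solution_domain by blast
    qed
  qed
  have yf: "y k \<in> effective_domain f" for k
    unfolding y_def using dom[of k] \<theta>[of k] by (intro effective_domain_segment f) auto
  have acc: "ereal (t k) * discrepancy f \<Psi> (x k) (y k) (s (Suc k)) (\<theta> k) / ereal (\<theta> k)
      \<le> bregman h (s (Suc k)) (s k)" for k
    using assms(16)[of k] or[of k]
    by (auto simp: r_large_def acceptable_def Let_def \<theta>_def y_def S_def)
  have "1 / (r powr \<gamma> * L) \<le> t k * (t k / (t k + S k)) powr (\<gamma> - 1)" for k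
  proof (rule large_stepsize_lower_bound[OF t S0 \<open>L > 0\<close> \<open>\<gamma> > 1\<close> \<open>r > 1\<close>])
    fix \<tau> :: real
    assume "\<tau> > 0" "L * \<tau> * (\<tau> / (\<tau> + S k)) powr (\<gamma> - 1) \<le> 1"
    then have "acceptable f \<Psi> h orac (x k) (s k) (S k) \<tau>"
      using dom[of k] S0[of k]
      by (intro small_stepsize_acceptable[OF f \<Psi> h diff diffh sub assms(7,8,9) smooth \<open>L > 0\<close>]) auto
    then show "\<tau> / r \<le> t k"
      using assms(16)[of k] by (auto simp: r_large_def S_def)
  qed
  (* S k has k summands, the last of them with index k - 1. *)
  then have "1 / (r powr \<gamma> * L) * ((real (k - 1) + \<gamma>) / \<gamma>) powr \<gamma> \<le> (\<Sum>i\<le>k - 1. t i)"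
    using \<open>L > 0\<close> \<open>r > 1\<close> by (intro stepsize_sum_growth t \<open>\<gamma> > 1\<close>) (auto simp: sum_le)
  also have "\<dots> = S k"
    using k by (cases k) (simp_all add: S_def lessThan_Suc_atMost)
  finally have growth: "((real k + \<gamma> - 1) / \<gamma>) powr \<gamma> / (r powr \<gamma> * L) \<le> S k"
    using k by (simp add: of_nat_diff algebra_simps)
  define K where "K = \<gamma> powr \<gamma> * r powr \<gamma> * L"
  define N where "N = (real k + \<gamma> - 1) powr \<gamma>"
  have K: "K > 0" and N: "N > 0"
    using \<open>L > 0\<close> \<open>r > 1\<close> \<open>\<gamma> > 1\<close> k by (auto simp: K_def N_def)
  have Sk: "N / K \<le> S k"
    using growth \<open>\<gamma> > 1\<close> k by (simp add: N_def K_def powr_divide mult.assoc)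
  have xk: "x k \<in> effective_domain \<Psi>"
    using dom[of "k - 1"] k by simp
  have fin: "f v + \<Psi> v = ereal (?r (f v + \<Psi> v))" if "v \<in> effective_domain \<Psi>" for v
    using that sub effective_domain_iff_real[OF f] effective_domain_iff_real[OF \<Psi>]
    by (metis plus_ereal.simps(1) real_of_ereal.simps(1) subsetD)
  have "(f (x k) + \<Psi> (x k)) - (f u + \<Psi> u) \<le> ereal K * bregman h u (x 0) / ereal N"
  proof (cases "u \<in> effective_domain \<Psi>")
    case False
    then have "f u + \<Psi> u = \<infinity>"
      using f by (auto simp: effective_domain_def convex_function_def)
    then have "(f (x k) + \<Psi> (x k)) - (f u + \<Psi> u) = -\<infinity>"
      by (subst fin[OF xk]) (simp only: ereal_minus)
    then show ?thesis by simp
  next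
    case u\<Psi>: True
    show ?thesis
    proof (cases "u \<in> effective_domain h")
      case False
      then have "bregman h u (x 0) = \<infinity>"
        using x0(2) effective_domain_iff_real[OF h, of "x 0"]
        by (cases "h (x 0)") (auto simp: bregman_def effective_domain_def)
      then show ?thesis
        using K N by simp
    next
      case uh: True
      have "S k * (?r (f (x k) + \<Psi> (x k)) - ?r (f u + \<Psi> u)) + ?r (bregman h u (s k))
          \<le> ?r (bregman h u (x 0))" for k
      proof (induction k)
        case 0
        then show ?case by (simp add: S_def x0)
      next
        case (Suc k)
        have "S (Suc k) = t k + S k"
          by (simp add: S_def)
        then show ?case
          using Suc dom[of k] accelerated_step_estimate[OF f \<Psi> h diff diffh sub t S0 \<theta>_def yf
              _ _ acc xSuc u\<Psi> uh] by fastforce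
      qed
      from this[of k] have bound:
        "S k * (?r (f (x k) + \<Psi> (x k)) - ?r (f u + \<Psi> u)) \<le> ?r (bregman h u (x 0))"
        using bregman_nonneg[OF h diffh _ uh, of "s k"] dom[of k] by linarith
      define G where "G = ?r (f (x k) + \<Psi> (x k)) - ?r (f u + \<Psi> u)"
      define D where "D = ?r (bregman h u (x 0))"
      have D0: "0 \<le> D"
        unfolding D_def by (rule bregman_nonneg[OF h diffh x0(2) uh])
      have "G \<le> K * D / N"
      proof (cases "G \<le> 0")
        case True
        then show ?thesis
          using K N D0 by (smt (verit) divide_nonneg_pos mult_nonneg_nonneg)
      next
        case False
        then have "N / K * G \<le> S k * G"
          using Sk by (intro mult_right_mono) auto
        also have "\<dots> \<le> D"
          using bound by (simp add: G_def D_def)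
        finally show ?thesis
          using K N by (simp add: field_simps)
      qed
      moreover have "bregman h u (x 0) = ereal D"
        using bregman_eq_real[OF h x0(2) uh] by (simp add: D_def)
      ultimately show ?thesis
        using N fin[OF xk] fin[OF u\<Psi>] unfolding G_def
        by (metis ereal_divide ereal_less_eq(3) ereal_minus(1) order_less_irrefl times_ereal.simps(1))
    qed
  qed
  then show "(f (x k) + \<Psi> (x k)) - (f u + \<Psi> u)
      \<le> ereal (\<gamma> powr \<gamma> * r powr \<gamma> * L) * bregman h u (x 0) / ereal ((real k + \<gamma> - 1) powr \<gamma>)"
    by (simp only: K_def N_def)
qed

end
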